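(* Let $X^*\sim(\nu^*,\mathbf P^* )$ be an absorbing Markov chain on $\mathbb E^*=\{\mathbf e_1,\ldots,\mathbf e_M\}$ with the unique absorbing state $\mathbf e_M$. Let $\mathcal C$ be the class of all partial orderings on $\mathbb E^*$ with $\mathbf e_M$ being the unique maximal state, each ordering $\preceq$ being identified with the matrix $\mathbf C(\mathbf e_i,\mathbf e_j)=\mathbf 1(\mathbf e_i\preceq \mathbf e_j)$. For a probability distribution $\pi$ on $\mathbb E^*$ with $\pi(\mathbf e)>0$ for all $\mathbf e$, and $\mathbf C\in\mathcal C$, put $$\widehat{\mathbf P^*}=\mathrm{diag}(\boldsymbol\pi\mathbf C)\,\mathbf P^*\,(\mathrm{diag}(\boldsymbol\pi\mathbf C))^{-1},\qquad \Lambda=(\mathrm{diag}(\boldsymbol\pi\mathbf C))^{-1}\,\mathbf C^T\,\mathrm{diag}(\boldsymbol\pi),$$ and let $$\mathcal P(\mathbf P^* )=\left\{(\pi,\mathbf C):\ \mathbf C\in\mathcal C,\ (\mathbf C^T)^{-1}\,\widehat{\mathbf P^*}\,\mathbf C^T\geq 0 \text{ entrywise}\right\}.$$ Then for any $(\pi,\mathbf C)\in\mathcal P(\mathbf P^* )$ the chain $X\sim(\nu,\mathbf P)$ with $$\nu=\nu^*\Lambda,\qquad \mathbf P=(\mathrm{diag}(\boldsymbol\pi))^{-1}(\mathbf C^T)^{-1}\,\widehat{\mathbf P^*}\,\mathbf C^T\,\mathrm{diag}(\boldsymbol\pi)$$ is a sharp antidual of $X^*$ with link $\Lambda$ (i.e.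 $X^*$ is a sharp strong stationary dual of $X$), the stationary distribution of $X$ being $\pi$. Equivalently, $\mathbf P=\Lambda^{-1}\mathbf P^*\Lambda$.
   Context: All chains are discrete-time on finite state spaces; $X\sim(\nu,\mathbf P)$ means initial distribution $\nu$ (row vector) and transition matrix $\mathbf P$. "Absorbing chain with unique absorbing state $\mathbf e_M$" means that $\mathbf e_M$ is the unique absorbing state and $\{\mathbf e_M\}$ is the unique recurrent (irreducible closed) class of $X^*$. $T^*$ denotes the absorption time of $X^*$ in $\mathbf e_M$. For $g:\mathbb E^*\to\mathbb R$ the row vector is $\boldsymbol g=(g(\mathbf e_1),\ldots,g(\mathbf e_M))$ and $\mathrm{diag}(\boldsymbol g)$ is the diagonal matrix with these entries. "Ergodic" means irreducible and aperiodic. Separation: $sep(\nu\mathbf P^k,\pi)=\max_{\mathbf e}\left(1-\nu\mathbf P^k(\mathbf e)/\pi(\mathbf e)\right)$. Link and duality: a stochastic matrix $\Lambda$ on $\mathbb E^*\times\mathbb E^*$ is a link if $\Lambda(\mathbf e_M,\mathbf e)=\pi(\mathbf e)$ for all $\mathbf e$. $X^*$ is a strong stationary dual (SSD) of the ergodic chain $X$ with stationary distribution $\pi$, with link $\Lambda$, if $\nu=\nu^*\Lambda$ and $\Lambda\mathbf P=\mathbf P^*\Lambda$; it is a sharp SSD if moreover $sep(\nu\mathbf P^k,\pi)=P(T^*>k)$ for all $k\ge 0$. In that case $X$ is called a sharp antidual of $X^*$. *)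

theory Defs
  imports "HOL-Probability.Probability"
begin

text \<open>
  The state space is a finite type \<open>'n\<close>. Distributions are row vectors, acting on matrices from
  the left by \<open>v*\<close>; the power \<open>^\<close> on matrices would be entrywise, hence \<open>mpow\<close>.
\<close>

primrec mpow :: "real^'n^'n \<Rightarrow> nat \<Rightarrow> real^'n^'n" where
  "mpow P 0 = mat 1"
| "mpow P (Suc k) = mpow P k ** P"

definition diag :: "real^'n \<Rightarrow> real^'n^'n" where
  "diag g = (\<chi> i j. if i = j then g $ i else 0)"

definition distribution :: "real^'n \<Rightarrow> bool" where
  "distribution \<mu> \<longleftrightarrow> (\<forall>i. 0 \<le> \<mu> $ i) \<and> (\<Sum>i\<in>UNIV. \<mu> $ i) = 1"

definition stochastic :: "real^'n^'n \<Rightarrow> bool" where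
  "stochastic P \<longleftrightarrow> (\<forall>i. distribution (P $ i))"


section \<open>Markov chains\<close>

definition markov_chain ::
    "'a measure \<Rightarrow> (nat \<Rightarrow> 'a \<Rightarrow> 'n::finite) \<Rightarrow> real^'n \<Rightarrow> real^'n^'n \<Rightarrow> bool" where
  "markov_chain N X \<nu> P \<longleftrightarrow>
     prob_space N \<and> distribution \<nu> \<and> stochastic P \<and>
     (\<forall>k. X k \<in> measurable N (count_space UNIV)) \<and>
     (\<forall>i. \<P>(\<omega> in N. X 0 \<omega> = i) = \<nu> $ i) \<and>
     (\<forall>k (x :: nat \<Rightarrow> 'n) j.
        \<P>(\<omega> in N. \<forall>l\<le>k. X l \<omega> = x l) > 0 \<longrightarrow>
        \<P>(\<omega> in N. X (Suc k) \<omega> = j \<bar> \<forall>l\<le>k. X l \<omega> = x l) = P $ x k $ j)"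

definition reaches :: "real^'n^'n \<Rightarrow> 'n \<Rightarrow> 'n \<Rightarrow> bool" where
  "reaches P i j \<longleftrightarrow> (\<exists>k. mpow P k $ i $ j > 0)"

definition irreducible_chain :: "real^'n^'n \<Rightarrow> bool" where
  "irreducible_chain P \<longleftrightarrow> (\<forall>i j. reaches P i j)"

definition aperiodic_chain :: "real^'n^'n \<Rightarrow> bool" where
  "aperiodic_chain P \<longleftrightarrow> (\<forall>i. Gcd {k. k > 0 \<and> mpow P k $ i $ i > 0} = 1)"

definition ergodic_chain :: "real^'n^'n \<Rightarrow> bool" where
  "ergodic_chain P \<longleftrightarrow> irreducible_chain P \<and> aperiodic_chain P"

definition stationary :: "real^'n \<Rightarrow> real^'n^'n \<Rightarrow> bool" where
  "stationary \<pi> P \<longleftrightarrow> distribution \<pi> \<and> \<pi> v* P = \<pi>"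

definition recurrent_class :: "real^'n^'n \<Rightarrow> 'n set \<Rightarrow> bool" where
  "recurrent_class P A \<longleftrightarrow>
     A \<noteq> {} \<and> (\<forall>i\<in>A. \<forall>j. j \<notin> A \<longrightarrow> P $ i $ j = 0) \<and> (\<forall>i\<in>A. \<forall>j\<in>A. reaches P i j)"

definition absorbing_chain :: "'n \<Rightarrow> real^'n^'n \<Rightarrow> bool" where
  "absorbing_chain m P \<longleftrightarrow>
     (\<forall>i. P $ i $ i = 1 \<longleftrightarrow> i = m) \<and> (\<forall>A. recurrent_class P A \<longleftrightarrow> A = {m})"

text \<open>The value is \<open>\<infinity>\<close> if \<open>m\<close> is never reached.\<close>

definition absorption_time :: "'n \<Rightarrow> (nat \<Rightarrow> 'a \<Rightarrow> 'n) \<Rightarrow> 'a \<Rightarrow> enat" where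
  "absorption_time m X \<omega> = (INF k\<in>{k. X k \<omega> = m}. enat k)"

definition sep :: "real^'n \<Rightarrow> real^'n \<Rightarrow> real" where
  "sep \<mu> \<pi> = (MAX i. 1 - \<mu> $ i / \<pi> $ i)"


section \<open>Strong stationary duality\<close>

definition link :: "'n \<Rightarrow> real^'n \<Rightarrow> real^'n^'n \<Rightarrow> bool" where
  "link m \<pi> \<Lambda> \<longleftrightarrow> stochastic \<Lambda> \<and> (\<forall>i. \<Lambda> $ m $ i = \<pi> $ i)"

text \<open>
  \<open>ssd m \<nu>' P' \<nu> P \<pi> \<Lambda>\<close>: the chain \<open>(\<nu>', P')\<close> with absorbing state \<open>m\<close> is a strong stationary dual,
  with link \<open>\<Lambda>\<close>, of the ergodic chain \<open>(\<nu>, P)\<close> with stationary distribution \<open>\<pi>\<close>.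
\<close>

definition ssd ::
    "'n \<Rightarrow> real^'n \<Rightarrow> real^'n^'n \<Rightarrow> real^'n \<Rightarrow> real^'n^'n \<Rightarrow> real^'n \<Rightarrow> real^'n^'n \<Rightarrow> bool" where
  "ssd m \<nu>' P' \<nu> P \<pi> \<Lambda> \<longleftrightarrow>
     absorbing_chain m P' \<and>
     distribution \<nu> \<and> stochastic P \<and> ergodic_chain P \<and> stationary \<pi> P \<and>
     link m \<pi> \<Lambda> \<and> \<nu> = \<nu>' v* \<Lambda> \<and> \<Lambda> ** P = P' ** \<Lambda>"

text \<open>
  The dual enters as a process \<open>X'\<close> because its absorption time is a random variable; of the
  antidual only the initial distribution \<open>\<nu>\<close> and the transition matrix \<open>P\<close> matter.
\<close>

definition sharp_antidual ::
    "'a measure \<Rightarrow> (nat \<Rightarrow> 'a \<Rightarrow> 'n::finite) \<Rightarrow> 'n \<Rightarrow> real^'n \<Rightarrow> real^'n^'n \<Rightarrow>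
     real^'n \<Rightarrow> real^'n^'n \<Rightarrow> real^'n \<Rightarrow> real^'n^'n \<Rightarrow> bool" where
  "sharp_antidual N X' m \<nu>' P' \<nu> P \<pi> \<Lambda> \<longleftrightarrow>
     markov_chain N X' \<nu>' P' \<and> ssd m \<nu>' P' \<nu> P \<pi> \<Lambda> \<and>
     (\<forall>k. sep (\<nu> v* mpow P k) \<pi> = \<P>(\<omega> in N. enat k < absorption_time m X' \<omega>))"


section \<open>Antiduals from partial orders\<close>

definition order_matrix :: "('n \<times> 'n) set \<Rightarrow> real^'n^'n" where
  "order_matrix r = (\<chi> i j. of_bool ((i, j) \<in> r))"

definition order_matrices :: "'n \<Rightarrow> (real^'n^'n) set" where
  "order_matrices m =
     {order_matrix r | r. partial_order_on UNIV r \<and>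
        (\<forall>i. (\<forall>j. (i, j) \<in> r \<longrightarrow> j = i) \<longleftrightarrow> i = m)}"

definition hat :: "real^'n^'n \<Rightarrow> real^'n \<Rightarrow> real^'n^'n \<Rightarrow> real^'n^'n" where
  "hat P' \<pi> C = diag (\<pi> v* C) ** P' ** matrix_inv (diag (\<pi> v* C))"

definition order_link :: "real^'n \<Rightarrow> real^'n^'n \<Rightarrow> real^'n^'n" where
  "order_link \<pi> C = matrix_inv (diag (\<pi> v* C)) ** transpose C ** diag \<pi>"

definition admissible_pairs :: "'n \<Rightarrow> real^'n^'n \<Rightarrow> ((real^'n) \<times> (real^'n^'n)) set" where
  "admissible_pairs m P' =
     {(\<pi>, C). distribution \<pi> \<and> (\<forall>i. \<pi> $ i > 0) \<and> C \<in> order_matrices m \<and>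
        (\<forall>i j. 0 \<le> (matrix_inv (transpose C) ** hat P' \<pi> C ** transpose C) $ i $ j)}"

definition antidual_matrix :: "real^'n^'n \<Rightarrow> real^'n \<Rightarrow> real^'n^'n \<Rightarrow> real^'n^'n" where
  "antidual_matrix P' \<pi> C =
     matrix_inv (diag \<pi>) ** matrix_inv (transpose C) ** hat P' \<pi> C ** transpose C ** diag \<pi>"

end

theory Submission
  imports Defs
begin

text \<open>
  Row \<open>i\<close> of the link \<open>\<Lambda>\<close> is \<open>\<pi>\<close> conditioned on the down-set of \<open>i\<close> (\<open>order_link_nth\<close>). Since \<open>m\<close>
  is the only maximal element of a finite order, it is the greatest element; hence its down-set is
  everything and row \<open>m\<close> is \<open>\<pi>\<close>. Up to diagonal factors, \<open>\<Lambda>\<close> is the transposed order matrix, which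
  is invertible by Moebius inversion, and the diagonal factors in the antidual matrix \<open>P\<close> are such
  that \<open>P = \<Lambda>\<^sup>-\<^sup>1 P' \<Lambda>\<close>. So the intertwining \<open>\<Lambda> P = P' \<Lambda>\<close> holds by construction.
  Admissibility says that \<open>P \<ge> 0\<close>, and the row sums are one because \<open>\<Lambda>\<close> and \<open>P'\<close>
  are stochastic.

  Ergodicity and stationarity both come from absorption. As \<open>{m}\<close> is the only recurrent class, the
  rows of \<open>P'\<^sup>k\<close> tend to the point mass at \<open>m\<close> (\<open>absorption_limit\<close>). Conjugating, the rows of \<open>P\<^sup>k\<close>
  tend to row \<open>m\<close> of \<open>\<Lambda>\<close>, which is \<open>\<pi>\<close> (\<open>conjugate_mpow_limit\<close>). As \<open>\<pi> > 0\<close>, every entry of \<open>P\<^sup>k\<close> is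
  positive for all large \<open>k\<close>, which gives irreducibility and aperiodicity at once. Stationarity is
  row \<open>m\<close> of the intertwining.

  For sharpness, let \<open>\<mu>\<close> be the law of the dual at time \<open>k\<close>; by the intertwining, the law of the
  antidual is \<open>\<mu> \<Lambda>\<close>. Its density with respect to \<open>\<pi>\<close> is smallest at \<open>m\<close>, where it equals
  \<open>\<mu>(m)\<close> (\<open>sep_order_link\<close>). So the separation is \<open>1 - \<mu>(m)\<close>, which is the probability that
  the dual has not been absorbed by time \<open>k\<close> (\<open>absorption_time_tail\<close>).
\<close>


section \<open>Matrices\<close>

lemma matrix_inv_mult:
  fixes A :: "real^'n^'n"
  assumes "invertible A"
  shows "A ** matrix_inv A = mat 1" "matrix_inv A ** A = mat 1"
  using someI_ex[OF assms[unfolded invertible_def]] by (auto simp: matrix_inv_def)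

lemma matrix_inv_eqI:
  fixes A B :: "real^'n^'n"
  assumes "A ** B = mat 1"
  shows "matrix_inv A = B"
proof -
  have "invertible A"
    using assms by (auto simp: invertible_right_inverse)
  then have "matrix_inv A ** (A ** B) = B"
    by (simp add: matrix_mul_assoc matrix_inv_mult)
  then show ?thesis
    by (simp add: assms)
qed

lemma diag_nth: "diag g $ i $ j = (if i = j then g $ i else 0)"
  by (simp add: diag_def)

lemma diag_mult_nth: "(diag g ** A) $ i $ j = g $ i * A $ i $ j"
  by (simp add: matrix_matrix_mult_def diag_nth if_distrib[of "\<lambda>x. x * _"] cong: if_cong)

lemma mult_diag_nth: "(A ** diag g) $ i $ j = A $ i $ j * g $ j"
  by (simp add: matrix_matrix_mult_def diag_nth if_distrib[of "\<lambda>x. _ * x"] cong: if_cong)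

lemma diag_mult_diag_inverse:
  assumes "\<And>i. g $ i \<noteq> 0"
  shows "diag g ** diag (\<chi> i. inverse (g $ i)) = mat 1"
  by (simp add: vec_eq_iff diag_mult_nth) (simp add: diag_nth mat_def assms)

lemma
  assumes "\<And>i. g $ i \<noteq> 0"
  shows invertible_diag: "invertible (diag g)"
    and matrix_inv_diag: "matrix_inv (diag g) = diag (\<chi> i. inverse (g $ i))"
  using diag_mult_diag_inverse[OF assms] matrix_inv_eqI
  by (auto simp: invertible_right_inverse)

lemma mpow_intertwine:
  assumes "L ** P = Q ** L"
  shows "L ** mpow P k = mpow Q k ** L"
proof (induction k)
  case (Suc k)
  have "L ** mpow P (Suc k) = mpow Q k ** (L ** P)"
    by (simp add: matrix_mul_assoc Suc.IH)
  then show ?case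
    by (simp add: assms matrix_mul_assoc)
qed simp


section \<open>Stochastic matrices\<close>

lemma stochastic_iff: "stochastic P \<longleftrightarrow> (\<forall>i j. 0 \<le> P $ i $ j) \<and> P *v 1 = 1"
  by (auto simp: stochastic_def distribution_def vec_eq_iff matrix_vector_mult_def)

lemma stochastic_nonneg: "stochastic P \<Longrightarrow> 0 \<le> P $ i $ j"
  by (simp add: stochastic_iff)

lemma stochastic_row_sum: "stochastic P \<Longrightarrow> (\<Sum>j\<in>UNIV. P $ i $ j) = 1"
  by (simp add: stochastic_def distribution_def)

lemma stochastic_mult:
  assumes "stochastic P" "stochastic Q"
  shows "stochastic (P ** Q)"
  using assms unfolding stochastic_iff
  by (auto simp: matrix_vector_mul_assoc[symmetric])
    (auto simp: matrix_matrix_mult_def intro!: sum_nonneg)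

lemma stochastic_mpow: "stochastic P \<Longrightarrow> stochastic (mpow P k)"
proof (induction k)
  case 0
  show ?case
    by (simp add: stochastic_def distribution_def mat_def)
qed (simp add: stochastic_mult)

lemma distribution_mult:
  assumes "distribution \<mu>" "stochastic P"
  shows "distribution (\<mu> v* P)"
proof -
  have "(\<Sum>j\<in>UNIV. (\<mu> v* P) $ j) = (\<Sum>i\<in>UNIV. \<mu> $ i * (\<Sum>j\<in>UNIV. P $ i $ j))"
    unfolding vector_matrix_mult_def sum_distrib_left
    by (simp add: mult.commute) (rule sum.swap)
  then show ?thesis
    using assms stochastic_nonneg[OF assms(2)] stochastic_row_sum[OF assms(2)]
    by (auto simp: distribution_def vector_matrix_mult_def intro!: sum_nonneg mult_nonneg_nonneg)
qed

lemma mpow_add: "mpow P (k + l) = mpow P k ** mpow P l"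
  by (induction l) (simp_all add: matrix_mul_assoc)

lemma reaches_refl: "reaches P i i"
  by (auto simp: reaches_def mat_def intro!: exI[of _ 0])

lemma mpow_add_ge:
  assumes "stochastic P"
  shows "mpow P k $ i $ j * mpow P l $ j $ t \<le> mpow P (k + l) $ i $ t"
  unfolding mpow_add matrix_matrix_mult_def
  using stochastic_nonneg[OF stochastic_mpow[OF assms]]
  by (auto intro!: member_le_sum[of j UNIV "\<lambda>x. mpow P k $ i $ x * mpow P l $ x $ t"])

lemma reaches_trans:
  assumes "stochastic P" "reaches P i j" "reaches P j t"
  shows "reaches P i t"
proof -
  obtain k l where "mpow P k $ i $ j > 0" "mpow P l $ j $ t > 0"
    using assms by (auto simp: reaches_def)
  then have "0 < mpow P k $ i $ j * mpow P l $ j $ t"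
    by simp
  also have "\<dots> \<le> mpow P (k + l) $ i $ t"
    by (rule mpow_add_ge[OF assms(1)])
  finally show ?thesis
    by (auto simp: reaches_def)
qed

lemma reaches_step:
  assumes "P $ i $ j > 0"
  shows "reaches P i j"
  using assms by (auto simp: reaches_def intro!: exI[of _ 1])

text \<open>Return times to a state then include two consecutive numbers, so their gcd is one.\<close>

lemma ergodic_if_eventually_positive:
  assumes pos: "\<And>i j. \<forall>\<^sub>F k in sequentially. mpow P k $ i $ j > 0"
  shows "ergodic_chain P"
proof -
  have "\<exists>k. mpow P k $ i $ j > 0" for i j
    using eventually_happens[OF pos[of i j]] by simp
  moreover have "Gcd {k. k > 0 \<and> mpow P k $ i $ i > 0} = 1" (is "Gcd ?K = 1") for i
  proof -
    obtain k0 where k0: "\<And>k. k \<ge> k0 \<Longrightarrow> mpow P k $ i $ i > 0"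
      using pos[of i i] by (auto simp: eventually_sequentially)
    have "Gcd ?K dvd Suc k0" "Gcd ?K dvd Suc (Suc k0)"
      using k0[of "Suc k0"] k0[of "Suc (Suc k0)"] by (auto intro!: Gcd_dvd simp del: mpow.simps)
    then have "Gcd ?K dvd Suc (Suc k0) - Suc k0"
      by (rule dvd_diff_nat[rotated])
    then show ?thesis
      by simp
  qed
  ultimately show ?thesis
    by (simp add: ergodic_chain_def irreducible_chain_def aperiodic_chain_def reaches_def)
qed


section \<open>Absorption\<close>

lemma absorbing_row:
  assumes "stochastic P" "absorbing_chain m P"
  shows "P $ m $ j = of_bool (j = m)"
proof -
  have one: "P $ m $ m = 1"
    using assms(2) by (simp add: absorbing_chain_def)
  have "(\<Sum>j\<in>UNIV - {m}. P $ m $ j) = 0"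
    using stochastic_row_sum[OF assms(1), of m] by (simp add: sum.remove[of UNIV m] one)
  then have "\<forall>j\<in>UNIV - {m}. P $ m $ j = 0"
    using stochastic_nonneg[OF assms(1)] by (subst (asm) sum_nonneg_eq_0_iff) auto
  then show ?thesis
    using one by auto
qed

text \<open>
  Among the states reachable from \<open>i\<close>, one with the fewest successors lies in a recurrent class;
  the only such class is \<open>{m}\<close>.
\<close>

lemma absorbing_reaches:
  assumes st: "stochastic P" and ab: "absorbing_chain m P"
  shows "reaches P i m"
proof -
  let ?S = "\<lambda>i. {j. reaches P i j}"
  obtain j where j: "reaches P i j" and least: "\<And>l. reaches P i l \<Longrightarrow> card (?S j) \<le> card (?S l)"
    using arg_min_nat_lemma[of "reaches P i" i "\<lambda>j. card (?S j)"] reaches_refl by blast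
  have return: "reaches P l j" if "reaches P j l" for l
  proof -
    have "?S l \<subseteq> ?S j"
      using that reaches_trans[OF st] by blast
    moreover have "card (?S j) \<le> card (?S l)"
      using that j reaches_trans[OF st] by (intro least) blast
    ultimately have "?S l = ?S j"
      by (intro card_seteq) auto
    then show ?thesis
      using reaches_refl[of P j] by auto
  qed
  have "recurrent_class P (?S j)"
    unfolding recurrent_class_def
  proof (intro conjI ballI allI impI)
    show "?S j \<noteq> {}"
      using reaches_refl by auto
  next
    fix a b assume a: "a \<in> ?S j" and "b \<notin> ?S j"
    then have "\<not> P $ a $ b > 0"
      using reaches_trans[OF st] reaches_step by blast
    then show "P $ a $ b = 0"
      using stochastic_nonneg[OF st, of a b] by linarith
  next
    fix a b assume "a \<in> ?S j" and "b \<in> ?S j"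
    then show "reaches P a b"
      using return reaches_trans[OF st] by blast
  qed
  then have "?S j = {m}"
    using ab by (simp add: absorbing_chain_def)
  then show ?thesis
    using j reaches_trans[OF st] by blast
qed

text \<open>
  The probabilities \<open>P\<^sup>k(i, m)\<close> increase with \<open>k\<close>; their limit \<open>h\<close> is harmonic with \<open>h(m) = 1\<close>.
  By the minimum principle, a state where \<open>h\<close> is minimal cannot have \<open>h < 1\<close>, because from there
  \<open>m\<close> is reached with positive probability.
\<close>

lemma absorption_limit:
  assumes st: "stochastic P" and ab: "absorbing_chain m P"
  shows "(\<lambda>k. mpow P k $ i $ m) \<longlonglongrightarrow> 1"
proof -
  note nn = stochastic_nonneg[OF stochastic_mpow[OF st]]
  note rs = stochastic_row_sum[OF stochastic_mpow[OF st]]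
  have le1: "mpow P k $ a $ m \<le> 1" for k a
    using member_le_sum[of m UNIV "\<lambda>j. mpow P k $ a $ j"] nn rs by auto
  have mm: "P $ m $ m = 1"
    using absorbing_row[OF st ab] by simp
  have inc: "incseq (\<lambda>k. mpow P k $ a $ m)" for a
    using mpow_add_ge[OF st, of _ a m 1 m] mm by (intro incseq_SucI) simp
  define h where "h a = lim (\<lambda>k. mpow P k $ a $ m)" for a
  have lim: "(\<lambda>k. mpow P k $ a $ m) \<longlonglongrightarrow> h a" for a
    unfolding h_def convergent_LIMSEQ_iff[symmetric]
    using inc[of a] le1 nn by (intro Bseq_mono_convergent BseqI'[of _ 1]) (auto simp: incseq_def)
  have h_le: "h a \<le> 1" for a
    by (rule LIMSEQ_le_const2[OF lim]) (auto simp: le1)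
  have "mpow P k $ m $ m = 1" for k
  proof -
    have "mpow P 0 $ m $ m \<le> mpow P k $ m $ m"
      using incseqD[OF inc[of m]] by blast
    then show ?thesis
      using le1[of k m] by (simp add: mat_def)
  qed
  then have hm: "h m = 1"
    using LIMSEQ_unique[OF lim[of m]] by simp
  have harmonic: "h a = (\<Sum>j\<in>UNIV. mpow P k $ a $ j * h j)" for k a
  proof (rule LIMSEQ_unique)
    show "(\<lambda>l. mpow P (l + k) $ a $ m) \<longlonglongrightarrow> h a"
      by (rule LIMSEQ_ignore_initial_segment[OF lim])
    show "(\<lambda>l. mpow P (l + k) $ a $ m) \<longlonglongrightarrow> (\<Sum>j\<in>UNIV. mpow P k $ a $ j * h j)"
      unfolding add.commute[of _ k] mpow_add matrix_matrix_mult_def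
      by (auto intro!: tendsto_intros lim)
  qed
  have "Min (range h) \<in> range h"
    by (intro Min_in) auto
  then obtain a where "Min (range h) = h a"
    by (rule rangeE)
  then have a: "h a \<le> h j" for j
    by (metis Min_le finite finite_imageI rangeI)
  have "h a = 1"
  proof (rule ccontr)
    assume "h a \<noteq> 1"
    then have lt: "h a < h m"
      using h_le[of a] hm by simp
    obtain k where k: "mpow P k $ a $ m > 0"
      using absorbing_reaches[OF st ab, of a] by (auto simp: reaches_def)
    have "(\<Sum>j\<in>UNIV. mpow P k $ a $ j * h a) < (\<Sum>j\<in>UNIV. mpow P k $ a $ j * h j)"
      using k lt a nn by (intro sum_strict_mono_ex1) (auto intro!: mult_left_mono exI[of _ m])
    then show False
      using rs[of k a] harmonic[of a k] by (simp add: sum_distrib_right[symmetric])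
  qed
  then have "h i = 1"
    using a[of i] h_le[of i] by simp
  then show ?thesis
    using lim[of i] by simp
qed

lemma absorption_limit_other:
  assumes st: "stochastic P" and ab: "absorbing_chain m P"
  shows "(\<lambda>k. mpow P k $ i $ j) \<longlonglongrightarrow> of_bool (j = m)"
proof (cases "j = m")
  case False
  note nn = stochastic_nonneg[OF stochastic_mpow[OF st]]
  have le: "mpow P k $ i $ j \<le> 1 - mpow P k $ i $ m" for k
    using stochastic_row_sum[OF stochastic_mpow[OF st], of k i] False
      sum_mono2[of UNIV "{j, m}" "\<lambda>j. mpow P k $ i $ j"] nn by auto
  have lim: "(\<lambda>k. 1 - mpow P k $ i $ m) \<longlonglongrightarrow> 0"
    using tendsto_diff[OF tendsto_const absorption_limit[OF assms], of 1] by simp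
  have "(\<lambda>k. mpow P k $ i $ j) \<longlonglongrightarrow> 0"
    by (rule tendsto_sandwich[OF _ _ tendsto_const lim]) (auto simp: nn le)
  then show ?thesis
    using False by simp
qed (simp add: absorption_limit[OF assms])


section \<open>The law of a Markov chain\<close>

text \<open>
  The Markov property is stated for full histories; summing over the histories that end in \<open>i\<close>
  gives it for the present state alone.
\<close>

lemma markov_chain_step:
  assumes mc: "markov_chain N X \<nu> P"
  shows "\<P>(\<omega> in N. X k \<omega> = i \<and> X (Suc k) \<omega> = j) = \<P>(\<omega> in N. X k \<omega> = i) * P $ i $ j"
proof -
  interpret prob_space N
    using mc by (simp add: markov_chain_def)
  have meas[measurable]: "X k \<in> measurable N (count_space UNIV)" for k
    using mc by (simp add: markov_chain_def)
  define E where "E x = {\<omega> \<in> space N. \<forall>l\<le>k. X l \<omega> = x l}" for x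
  define F where "F = {\<omega> \<in> space N. X (Suc k) \<omega> = j}"
  define H where "H = {x \<in> {..k} \<rightarrow>\<^sub>E (UNIV :: 'b set). x k = i}"
  have Em: "E x \<in> events" for x
    unfolding E_def by measurable
  have Fm: "F \<in> events"
    unfolding F_def by measurable
  have fin: "finite H"
    unfolding H_def by (rule finite_subset[of _ "{..k} \<rightarrow>\<^sub>E UNIV"]) (auto intro: finite_PiE)
  have disj: "disjoint_family_on E H"
    unfolding disjoint_family_on_def
  proof (intro ballI impI)
    fix x y assume "x \<in> H" "y \<in> H" "x \<noteq> y"
    then obtain l where "l \<le> k" "x l \<noteq> y l"
      unfolding H_def by (metis (mono_tags, lifting) PiE_ext atMost_iff mem_Collect_eq)
    then show "E x \<inter> E y = {}"
      by (auto simp: E_def)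
  qed
  have un: "{\<omega> \<in> space N. X k \<omega> = i} = (\<Union>x\<in>H. E x)"
  proof (intro equalityI subsetI)
    fix \<omega> assume "\<omega> \<in> {\<omega> \<in> space N. X k \<omega> = i}"
    then have "restrict (\<lambda>l. X l \<omega>) {..k} \<in> H" "\<omega> \<in> E (restrict (\<lambda>l. X l \<omega>) {..k})"
      by (auto simp: H_def E_def)
    then show "\<omega> \<in> (\<Union>x\<in>H. E x)"
      by blast
  qed (auto simp: H_def E_def)
  have step: "prob (E x \<inter> F) = prob (E x) * P $ i $ j" if "x \<in> H" for x
  proof (cases "prob (E x) > 0")
    case True
    have "\<P>(\<omega> in N. X (Suc k) \<omega> = j \<bar> \<forall>l\<le>k. X l \<omega> = x l) = P $ x k $ j"
      using mc True unfolding markov_chain_def E_def by blast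
    moreover have "{\<omega> \<in> space N. X (Suc k) \<omega> = j \<and> (\<forall>l\<le>k. X l \<omega> = x l)} = E x \<inter> F"
      by (auto simp: E_def F_def)
    ultimately have "prob (E x \<inter> F) / prob (E x) = P $ x k $ j"
      by (simp add: cond_prob_def E_def)
    then show ?thesis
      using True that by (simp add: H_def field_simps)
  next
    case False
    then have "prob (E x) = 0"
      using measure_nonneg[of N "E x"] by linarith
    moreover have "prob (E x \<inter> F) \<le> prob (E x)"
      using Em by (intro finite_measure_mono) auto
    ultimately show ?thesis
      using measure_nonneg[of N "E x \<inter> F"] by simp
  qed
  have "{\<omega> \<in> space N. X k \<omega> = i \<and> X (Suc k) \<omega> = j} = (\<Union>x\<in>H. E x \<inter> F)"
    using un by (auto simp: F_def)
  also have "prob \<dots> = (\<Sum>x\<in>H. prob (E x \<inter> F))"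
    using fin Em Fm disj by (intro finite_measure_finite_Union) (auto simp: disjoint_family_on_def)
  also have "\<dots> = (\<Sum>x\<in>H. prob (E x)) * P $ i $ j"
    by (simp add: step sum_distrib_right)
  also have "(\<Sum>x\<in>H. prob (E x)) = prob (\<Union>x\<in>H. E x)"
    using fin Em disj by (intro finite_measure_finite_Union[symmetric]) auto
  finally show ?thesis
    unfolding un .
qed

lemma markov_chain_law:
  assumes mc: "markov_chain N X \<nu> P"
  shows "\<P>(\<omega> in N. X k \<omega> = i) = (\<nu> v* mpow P k) $ i"
proof (induction k arbitrary: i)
  case 0
  then show ?case
    using mc by (simp add: markov_chain_def)
next
  case (Suc k)
  interpret prob_space N
    using mc by (simp add: markov_chain_def)
  have meas[measurable]: "X k \<in> measurable N (count_space UNIV)" for k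
    using mc by (simp add: markov_chain_def)
  have "{\<omega> \<in> space N. X (Suc k) \<omega> = i} = (\<Union>a. {\<omega> \<in> space N. X k \<omega> = a \<and> X (Suc k) \<omega> = i})"
    by auto
  also have "prob \<dots> = (\<Sum>a\<in>UNIV. \<P>(\<omega> in N. X k \<omega> = a \<and> X (Suc k) \<omega> = i))"
    by (intro finite_measure_finite_Union) (auto simp: disjoint_family_on_def)
  also have "\<dots> = (\<Sum>a\<in>UNIV. (\<nu> v* mpow P k) $ a * P $ a $ i)"
    by (simp add: markov_chain_step[OF mc] Suc.IH)
  also have "\<dots> = ((\<nu> v* mpow P k) v* P) $ i"
    by (subst (2) vector_matrix_mult_def) (simp add: mult.commute)
  finally show ?case
    by (simp add: vector_matrix_mul_assoc)
qed

text \<open>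
  Almost surely the chain never leaves \<open>m\<close>, so that \<open>m\<close> has been visited up to time \<open>k\<close> if and
  only if the chain is in \<open>m\<close> at time \<open>k\<close>.
\<close>

lemma absorption_time_tail:
  assumes mc: "markov_chain N X \<nu> P" and ab: "absorbing_chain m P"
  shows "\<P>(\<omega> in N. enat k < absorption_time m X \<omega>) = 1 - (\<nu> v* mpow P k) $ m"
proof -
  interpret prob_space N
    using mc by (simp add: markov_chain_def)
  have meas[measurable]: "X k \<in> measurable N (count_space UNIV)" for k
    using mc by (simp add: markov_chain_def)
  have st: "stochastic P"
    using mc by (simp add: markov_chain_def)
  have tail: "enat k < absorption_time m X \<omega> \<longleftrightarrow> (\<forall>l\<le>k. X l \<omega> \<noteq> m)" for \<omega>
  proof
    assume "enat k < absorption_time m X \<omega>"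
    then show "\<forall>l\<le>k. X l \<omega> \<noteq> m"
      unfolding absorption_time_def
      by (metis (mono_tags, lifting) INF_lower enat_ord_simps(1) leD mem_Collect_eq order_trans)
  next
    assume "\<forall>l\<le>k. X l \<omega> \<noteq> m"
    then have "enat (Suc k) \<le> absorption_time m X \<omega>"
      unfolding absorption_time_def by (intro INF_greatest) (auto simp: not_less_eq_eq)
    then show "enat k < absorption_time m X \<omega>"
      by (rule less_le_trans[rotated]) simp
  qed
  have stay: "AE \<omega> in N. X l \<omega> = m \<longrightarrow> X (Suc l) \<omega> = m" for l
  proof -
    have "AE \<omega> in N. \<not> (X l \<omega> = m \<and> X (Suc l) \<omega> = j)" if "j \<noteq> m" for j
    proof -
      have "AE \<omega> in N. \<omega> \<notin> {\<omega> \<in> space N. X l \<omega> = m \<and> X (Suc l) \<omega> = j}"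
        using markov_chain_step[OF mc, of l m j] absorbing_row[OF st ab, of j] that
        by (subst prob_eq_0[symmetric]) auto
      with AE_space show ?thesis
        by eventually_elim auto
    qed
    then have "AE \<omega> in N. \<forall>j\<in>UNIV - {m}. \<not> (X l \<omega> = m \<and> X (Suc l) \<omega> = j)"
      by (intro AE_finite_allI) auto
    then show ?thesis
      by eventually_elim auto
  qed
  have "AE \<omega> in N. \<forall>l. X l \<omega> = m \<longrightarrow> X (Suc l) \<omega> = m"
    using stay by (simp add: AE_all_countable)
  then have "AE \<omega> in N. (\<forall>l\<le>k. X l \<omega> \<noteq> m) \<longleftrightarrow> X k \<omega> \<noteq> m"
  proof eventually_elim
    fix \<omega> assume stay: "\<forall>l. X l \<omega> = m \<longrightarrow> X (Suc l) \<omega> = m"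
    have "X k \<omega> = m" if "l \<le> k" "X l \<omega> = m" for l
      using that(1) by (induction k rule: dec_induct) (use that stay in auto)
    then show "(\<forall>l\<le>k. X l \<omega> \<noteq> m) \<longleftrightarrow> X k \<omega> \<noteq> m"
      by auto
  qed
  then have "\<P>(\<omega> in N. enat k < absorption_time m X \<omega>) = \<P>(\<omega> in N. X k \<omega> \<noteq> m)"
    unfolding tail by (rule prob_eq_AE) auto
  also have "\<dots> = 1 - \<P>(\<omega> in N. X k \<omega> = m)"
    by (rule prob_neg) auto
  finally show ?thesis
    by (simp add: markov_chain_law[OF mc])
qed


section \<open>Order matrices\<close>

text \<open>
  The transposed order matrix sums a function over down-sets. If all these sums vanish, then so
  does the function, by induction on the size of the down-set; hence Moebius inversion is possible.
\<close>

lemma invertible_transpose_order_matrix: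
  fixes r :: "('n::finite \<times> 'n) set"
  assumes r: "partial_order_on UNIV r"
  shows "invertible (transpose (order_matrix r))"
proof -
  have "x = 0" if 0: "transpose (order_matrix r) *v x = 0" for x
  proof -
    have sum0: "(\<Sum>j | (j, i) \<in> r. x $ j) = 0" for i
    proof -
      have "(transpose (order_matrix r) *v x) $ i = (\<Sum>j\<in>UNIV. of_bool ((j, i) \<in> r) * x $ j)"
        unfolding matrix_vector_mult_def by (simp add: transpose_def order_matrix_def)
      then show ?thesis
        using 0 by (simp add: of_bool_def if_distrib[of "\<lambda>x. x * _"] sum.If_cases cong: if_cong)
    qed
    have "x $ i = 0" for i
    proof (induction "card {j. (j, i) \<in> r}" arbitrary: i rule: less_induct)
      case less
      have refl: "(i, i) \<in> r"
        using r by (auto simp: order_on_defs refl_on_def)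
      have "x $ j = 0" if j: "(j, i) \<in> r" "j \<noteq> i" for j
      proof (rule less)
        have "(i, j) \<notin> r"
          using r j by (auto simp: order_on_defs dest: antisymD)
        then have "{l. (l, j) \<in> r} \<subset> {l. (l, i) \<in> r}"
          using r j refl by (auto simp: order_on_defs dest: transD)
        then show "card {l. (l, j) \<in> r} < card {l. (l, i) \<in> r}"
          by (intro psubset_card_mono) auto
      qed
      then have "(\<Sum>j | (j, i) \<in> r. x $ j) = x $ i"
        using refl by (subst sum.mono_neutral_right[of _ "{i}"]) auto
      then show ?case
        using sum0 by simp
    qed
    then show ?thesis
      by (simp add: vec_eq_iff)
  qed
  then show ?thesis
    by (simp add: invertible_left_inverse matrix_left_invertible_ker)
qed

text \<open>In a finite order a unique maximal element is the greatest element.\<close>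

lemma unique_maximal_is_greatest:
  fixes r :: "('n::finite \<times> 'n) set"
  assumes r: "partial_order_on UNIV r"
    and max: "\<And>i. (\<forall>j. (i, j) \<in> r \<longrightarrow> j = i) \<longleftrightarrow> i = m"
  shows "(i, m) \<in> r"
proof (induction "card {j. (i, j) \<in> r}" arbitrary: i rule: less_induct)
  case less
  have refl: "(i, i) \<in> r" for i
    using r by (auto simp: order_on_defs refl_on_def)
  show ?case
  proof (cases "i = m")
    case False
    then obtain j where j: "(i, j) \<in> r" "j \<noteq> i"
      using max by blast
    have "(j, i) \<notin> r"
      using r j by (auto simp: order_on_defs dest: antisymD)
    then have "{l. (j, l) \<in> r} \<subset> {l. (i, l) \<in> r}"
      using r j refl[of i] by (auto simp: order_on_defs dest: transD)
    then have "(j, m) \<in> r"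
      by (intro less psubset_card_mono) auto
    then show ?thesis
      using r j by (auto simp: order_on_defs dest: transD)
  qed (simp add: refl)
qed


section \<open>The link and the antidual chain\<close>

lemma down_set_mass: "(\<pi> v* order_matrix r) $ i = (\<Sum>j | (j, i) \<in> r. \<pi> $ j)"
  by (simp add: vector_matrix_mult_def order_matrix_def of_bool_def
      if_distrib[of "\<lambda>x. _ * x"] sum.If_cases cong: if_cong)

lemma down_set_mass_pos:
  fixes r :: "('n::finite \<times> 'n) set"
  assumes r: "partial_order_on UNIV r" and pos: "\<And>i. \<pi> $ i > 0"
  shows "(\<pi> v* order_matrix r) $ i > 0"
  unfolding down_set_mass using r pos
  by (intro sum_pos) (auto simp: order_on_defs refl_on_def)

text \<open>Row \<open>i\<close> of the link is \<open>\<pi>\<close> conditioned on the down-set of \<open>i\<close>.\<close>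

lemma order_link_nth:
  fixes r :: "('n::finite \<times> 'n) set"
  assumes r: "partial_order_on UNIV r" and pos: "\<And>i. \<pi> $ i > 0"
  shows "order_link \<pi> (order_matrix r) $ i $ j =
    of_bool ((j, i) \<in> r) * \<pi> $ j / (\<pi> v* order_matrix r) $ i"
proof -
  have "\<And>i. (\<pi> v* order_matrix r) $ i \<noteq> 0"
    using down_set_mass_pos[OF assms] by (simp add: less_imp_neq[symmetric])
  then show ?thesis
    by (simp add: order_link_def matrix_inv_diag mult_diag_nth diag_mult_nth field_simps)
      (simp add: transpose_def order_matrix_def)
qed

lemma stochastic_order_link:
  fixes r :: "('n::finite \<times> 'n) set"
  assumes r: "partial_order_on UNIV r" and pos: "\<And>i. \<pi> $ i > 0"
  shows "stochastic (order_link \<pi> (order_matrix r))"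
proof -
  have "(\<Sum>j\<in>UNIV. order_link \<pi> (order_matrix r) $ i $ j) = 1" for i
  proof -
    have "(\<Sum>j\<in>UNIV. order_link \<pi> (order_matrix r) $ i $ j) =
      (\<Sum>j\<in>UNIV. of_bool ((j, i) \<in> r) * \<pi> $ j) / (\<pi> v* order_matrix r) $ i"
      unfolding order_link_nth[OF assms] sum_divide_distrib ..
    also have "(\<Sum>j\<in>UNIV. of_bool ((j, i) \<in> r) * \<pi> $ j) = (\<pi> v* order_matrix r) $ i"
      by (simp add: vector_matrix_mult_def order_matrix_def mult.commute)
    finally show ?thesis
      using down_set_mass_pos[OF assms, of i] by simp
  qed
  moreover have "order_link \<pi> (order_matrix r) $ i $ j \<ge> 0" for i j
    using down_set_mass_pos[OF assms, of i] pos[of j]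
    by (auto simp: order_link_nth[OF assms] intro!: divide_nonneg_pos)
  ultimately show ?thesis
    by (auto simp: stochastic_def distribution_def)
qed

lemma
  fixes r :: "('n::finite \<times> 'n) set"
  assumes r: "partial_order_on UNIV r" and pos: "\<And>i. \<pi> $ i > 0"
  defines "C \<equiv> order_matrix r"
  shows invertible_order_link: "invertible (order_link \<pi> C)"
    and antidual_matrix_eq:
      "antidual_matrix P' \<pi> C = matrix_inv (order_link \<pi> C) ** P' ** order_link \<pi> C"
proof -
  let ?D = "diag \<pi>" and ?H = "diag (\<pi> v* C)" and ?T = "transpose C"
  have D: "invertible ?D"
    by (rule invertible_diag) (simp add: pos less_imp_neq[symmetric])
  have H: "invertible ?H"
    using down_set_mass_pos[OF r pos]
    by (intro invertible_diag) (simp add: C_def less_imp_neq[symmetric])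
  have T: "invertible ?T"
    unfolding C_def by (rule invertible_transpose_order_matrix[OF r])
  have "(matrix_inv ?H ** ?T ** ?D) ** (matrix_inv ?D ** matrix_inv ?T ** ?H) =
      matrix_inv ?H ** (?T ** (?D ** matrix_inv ?D) ** matrix_inv ?T) ** ?H"
    by (simp only: matrix_mul_assoc)
  also have "\<dots> = mat 1"
    by (simp add: matrix_inv_mult D T H)
  finally have *: "order_link \<pi> C ** (matrix_inv ?D ** matrix_inv ?T ** ?H) = mat 1"
    by (simp add: order_link_def)
  then show "invertible (order_link \<pi> C)"
    by (auto simp: invertible_right_inverse)
  show "antidual_matrix P' \<pi> C = matrix_inv (order_link \<pi> C) ** P' ** order_link \<pi> C"
    unfolding matrix_inv_eqI[OF *]
    by (simp add: antidual_matrix_def order_link_def hat_def matrix_mul_assoc)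
qed

lemma antidual_matrix_nonneg:
  assumes "(\<pi>, C) \<in> admissible_pairs m P'"
  shows "0 \<le> antidual_matrix P' \<pi> C $ i $ j"
proof -
  have pos: "\<And>i. \<pi> $ i > 0"
    and nn: "0 \<le> (matrix_inv (transpose C) ** hat P' \<pi> C ** transpose C) $ i $ j"
    using assms by (auto simp: admissible_pairs_def)
  have "antidual_matrix P' \<pi> C =
      matrix_inv (diag \<pi>) ** (matrix_inv (transpose C) ** hat P' \<pi> C ** transpose C) ** diag \<pi>"
    by (simp add: antidual_matrix_def matrix_mul_assoc)
  then have "antidual_matrix P' \<pi> C $ i $ j =
      inverse (\<pi> $ i) * (matrix_inv (transpose C) ** hat P' \<pi> C ** transpose C) $ i $ j * \<pi> $ j"
    using pos by (simp add: matrix_inv_diag less_imp_neq[symmetric] mult_diag_nth diag_mult_nth)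
  then show ?thesis
    using nn pos[of i] pos[of j] by simp
qed

lemma mult_matrix_inv_one:
  assumes "stochastic L" "invertible L"
  shows "matrix_inv L *v 1 = 1"
proof -
  have "matrix_inv L *v (L *v 1) = 1"
    by (simp add: matrix_vector_mul_assoc matrix_inv_mult assms)
  then show ?thesis
    using assms by (simp add: stochastic_iff)
qed

text \<open>
  Absorption concentrates every row of \<open>P'\<^sup>k\<close> at \<open>m\<close>, so that \<open>P\<^sup>k = L\<^sup>-\<^sup>1 P'\<^sup>k L\<close> tends to
  \<open>L\<^sup>-\<^sup>1\<close> applied to the matrix all of whose rows are row \<open>m\<close> of \<open>L\<close>. The rows of \<open>L\<^sup>-\<^sup>1\<close> sum
  to one, hence \<open>L\<^sup>-\<^sup>1\<close> leaves a matrix with equal rows unchanged.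
\<close>

lemma conjugate_mpow_limit:
  assumes L: "stochastic L" "invertible L"
    and P': "stochastic P'" "absorbing_chain m P'"
    and LP: "L ** P = P' ** L"
  shows "(\<lambda>k. mpow P k $ i $ j) \<longlonglongrightarrow> L $ m $ j"
proof -
  have "mpow P k = matrix_inv L ** (mpow P' k ** L)" for k
    unfolding mpow_intertwine[OF LP, symmetric] matrix_mul_assoc
    by (simp add: matrix_inv_mult L)
  then have eq: "mpow P k $ i $ j =
      (\<Sum>a\<in>UNIV. matrix_inv L $ i $ a * (\<Sum>b\<in>UNIV. mpow P' k $ a $ b * L $ b $ j))" for k
    by (simp add: matrix_matrix_mult_def)
  have "(\<Sum>a\<in>UNIV. matrix_inv L $ i $ a) = (matrix_inv L *v 1) $ i"
    by (simp add: matrix_vector_mult_def)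
  also have "\<dots> = 1"
    by (simp add: mult_matrix_inv_one[OF L])
  finally have rs: "(\<Sum>a\<in>UNIV. matrix_inv L $ i $ a) = 1" .
  have "(\<lambda>k. mpow P k $ i $ j) \<longlonglongrightarrow>
      (\<Sum>a\<in>UNIV. matrix_inv L $ i $ a * (\<Sum>b\<in>UNIV. of_bool (b = m) * L $ b $ j))"
    unfolding eq by (intro tendsto_intros absorption_limit_other P')
  also have "(\<Sum>a\<in>UNIV. matrix_inv L $ i $ a * (\<Sum>b\<in>UNIV. of_bool (b = m) * L $ b $ j)) =
      (\<Sum>a\<in>UNIV. matrix_inv L $ i $ a) * L $ m $ j"
    by (simp add: sum_distrib_right of_bool_def if_distrib[of "\<lambda>x. x * _"] cong: if_cong)
  finally show ?thesis
    by (simp add: rs)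
qed

text \<open>
  Mixing the conditioned laws with weights \<open>\<mu>\<close> gives the density
  \<open>i \<mapsto> \<Sum>j \<ge> i. \<mu>\<^sub>j / \<pi>(down-set of j)\<close> with respect to \<open>\<pi>\<close>. The greatest element \<open>m\<close> contributes
  \<open>\<mu>\<^sub>m\<close> at every \<open>i\<close>, and it is the only contribution at \<open>i = m\<close>: the density is minimal there.
\<close>

lemma sep_order_link:
  fixes r :: "('n::finite \<times> 'n) set"
  assumes r: "partial_order_on UNIV r"
    and max: "\<And>i. (\<forall>j. (i, j) \<in> r \<longrightarrow> j = i) \<longleftrightarrow> i = m"
    and pos: "\<And>i. \<pi> $ i > 0" and mass: "(\<pi> v* order_matrix r) $ m = 1"
    and nn: "\<And>i. \<mu> $ i \<ge> 0"
  shows "sep (\<mu> v* order_link \<pi> (order_matrix r)) \<pi> = 1 - \<mu> $ m"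
proof -
  let ?H = "\<lambda>i. (\<pi> v* order_matrix r) $ i"
  let ?f = "\<lambda>i j. of_bool ((i, j) \<in> r) * (\<mu> $ j / ?H j)"
  have Hpos: "?H i > 0" for i
    by (rule down_set_mass_pos[OF r pos])
  have density: "(\<mu> v* order_link \<pi> (order_matrix r)) $ i / \<pi> $ i = (\<Sum>j\<in>UNIV. ?f i j)" for i
    using pos[of i] by (subst vector_matrix_mult_def)
      (simp add: order_link_nth[OF r pos] sum_divide_distrib mult.commute mult.left_commute)
  have greatest: "(i, m) \<in> r" for i
    by (rule unique_maximal_is_greatest[OF r max])
  have ge: "\<mu> $ m \<le> (\<Sum>j\<in>UNIV. ?f i j)" for i
  proof -
    have "?f i m \<le> (\<Sum>j\<in>UNIV. ?f i j)"
      using nn Hpos by (intro member_le_sum) (auto intro!: divide_nonneg_pos)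
    then show ?thesis
      by (simp add: greatest mass)
  qed
  have "(m, j) \<in> r \<longleftrightarrow> j = m" for j
    using max greatest by blast
  then have "?f m j = (if j = m then \<mu> $ m else 0)" for j
    by (simp add: mass)
  then have eq: "(\<Sum>j\<in>UNIV. ?f m j) = \<mu> $ m"
    by (simp only: sum.delta finite UNIV_I if_True)
  show ?thesis
    unfolding sep_def density
    using ge eq by (intro Max_eqI) (auto intro!: image_eqI[of _ _ m])
qed

theorem theorem4p1:
  fixes N :: "'a measure" and X' :: "nat \<Rightarrow> 'a \<Rightarrow> 'n::finite" and m :: 'n
    and \<nu>' \<pi> :: "real^'n" and P' C :: "real^'n^'n"
  assumes "markov_chain N X' \<nu>' P'"
    and "absorbing_chain m P'"
    and "(\<pi>, C) \<in> admissible_pairs m P'"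
  shows "sharp_antidual N X' m \<nu>' P'
           (\<nu>' v* order_link \<pi> C) (antidual_matrix P' \<pi> C) \<pi> (order_link \<pi> C) \<and>
         invertible (order_link \<pi> C) \<and>
         antidual_matrix P' \<pi> C = matrix_inv (order_link \<pi> C) ** P' ** order_link \<pi> C"
proof -
  note mc = assms(1) and ab = assms(2)
  have st: "stochastic P'" and \<nu>': "distribution \<nu>'"
    using mc by (auto simp: markov_chain_def)
  have \<pi>: "distribution \<pi>" and pos: "\<And>i. \<pi> $ i > 0"
    using assms(3) by (auto simp: admissible_pairs_def)
  obtain r where C: "C = order_matrix r" and r: "partial_order_on UNIV r"
    and max: "\<And>i. (\<forall>j. (i, j) \<in> r \<longrightarrow> j = i) \<longleftrightarrow> i = m"
    using assms(3) by (auto simp: admissible_pairs_def order_matrices_def)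
  define L where "L = order_link \<pi> C"
  define P where "P = antidual_matrix P' \<pi> C"
  have L: "stochastic L" "invertible L"
    using stochastic_order_link[OF r pos] invertible_order_link[OF r pos]
    by (simp_all add: L_def C)
  have P: "P = matrix_inv L ** P' ** L"
    unfolding P_def L_def C by (rule antidual_matrix_eq[OF r pos])
  have LP: "L ** P = P' ** L"
    by (simp add: P matrix_mul_assoc matrix_inv_mult L)
  have greatest: "(i, m) \<in> r" for i
    by (rule unique_maximal_is_greatest[OF r max])
  have mass: "(\<pi> v* order_matrix r) $ m = 1"
    using \<pi> by (simp add: down_set_mass greatest distribution_def)
  have Lm: "L $ m $ i = \<pi> $ i" for i
    by (simp add: L_def C order_link_nth[OF r pos] greatest mass)
  have stP: "stochastic P"
  proof -
    have "P *v 1 = matrix_inv L *v (P' *v (L *v 1))"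
      by (simp add: P matrix_vector_mul_assoc matrix_mul_assoc)
    also have "\<dots> = 1"
      using L st mult_matrix_inv_one[OF L] by (simp add: stochastic_iff)
    finally show ?thesis
      using antidual_matrix_nonneg[OF assms(3)] by (simp add: stochastic_iff P_def)
  qed
  \<comment> \<open>Row \<open>m\<close> of the intertwining \<open>\<Lambda> P = P' \<Lambda>\<close> reads \<open>\<pi> P = \<pi>\<close>, since row \<open>m\<close> of \<open>P'\<close> is concentrated
     at \<open>m\<close>.\<close>
  have stat: "\<pi> v* P = \<pi>"
  proof -
    have "(\<pi> v* P) $ j = (L ** P) $ m $ j" for j
      by (simp add: vector_matrix_mult_def matrix_matrix_mult_def Lm mult.commute)
    also have "(L ** P) $ m $ j = \<pi> $ j" for j
      unfolding LP by (simp add: matrix_matrix_mult_def absorbing_row[OF st ab] Lm of_bool_def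
          if_distrib[of "\<lambda>x. x * _"] cong: if_cong)
    finally show ?thesis
      by (simp add: vec_eq_iff)
  qed
  have erg: "ergodic_chain P"
  proof (rule ergodic_if_eventually_positive)
    show "\<forall>\<^sub>F k in sequentially. mpow P k $ i $ j > 0" for i j
      using conjugate_mpow_limit[OF L st ab LP, of i j] pos[of j]
      by (intro order_tendstoD(1)[of _ "\<pi> $ j"]) (auto simp: Lm)
  qed
  have sharp: "sep ((\<nu>' v* L) v* mpow P k) \<pi> = \<P>(\<omega> in N. enat k < absorption_time m X' \<omega>)" for k
  proof -
    have "distribution (\<nu>' v* mpow P' k)"
      by (intro distribution_mult \<nu>' stochastic_mpow st)
    then have "sep ((\<nu>' v* mpow P' k) v* L) \<pi> = 1 - (\<nu>' v* mpow P' k) $ m"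
      unfolding L_def C by (intro sep_order_link[OF r max pos mass]) (simp add: distribution_def)
    then show ?thesis
      by (simp add: absorption_time_tail[OF mc ab] vector_matrix_mul_assoc mpow_intertwine[OF LP])
  qed
  have "ssd m \<nu>' P' (\<nu>' v* L) P \<pi> L"
    unfolding ssd_def stationary_def link_def
    using ab distribution_mult[OF \<nu>' L(1)] stP erg \<pi> stat L(1) Lm LP by simp
  then show ?thesis
    using mc sharp L(2) P unfolding sharp_antidual_def P_def L_def by simp
qed

end
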